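(* Every interval graph is a single approval interval graph, and there exist single approval interval graphs that are not interval graphs.
   Context: All graphs are finite and simple. A graph is an interval graph if one can assign to each vertex a closed real interval so that two distinct vertices are adjacent iff their intervals intersect. An approval interval is a triple $I(a)=(a_l,a_a,a_r)$ of reals with $a_l<a_a<a_r$. A single approval interval representation of a graph $G$ assigns to each vertex $a$ an approval interval $I(a)$ such that distinct vertices $a,b$ are adjacent if and only if $[a_l,a_r]$ and $[b_l,b_r]$ intersect and their intersection contains exactly one of the approval marks $a_a,b_a$. A graph is a single approval interval graph if it has such a representation. *)

theory Defs
  imports Complex_Main "Graph_Theory.Pair_Digraph"
begin

text \<open>Finite simple graphs are rendered by \<open>pair_graph\<close>: finite, loop-free, symmetric digraphs
  whose arcs are pairs of vertices, so \<open>(u, v) \<in> parcs G\<close> means that \<open>u\<close> and \<open>v\<close> are adjacent.\<close>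

definition interval_representation ::
    "'a pair_pre_digraph \<Rightarrow> ('a \<Rightarrow> real) \<Rightarrow> ('a \<Rightarrow> real) \<Rightarrow> bool" where
  "interval_representation G l r \<longleftrightarrow>
     (\<forall>u \<in> pverts G. l u \<le> r u) \<and>
     (\<forall>u \<in> pverts G. \<forall>v \<in> pverts G. u \<noteq> v \<longrightarrow>
        ((u, v) \<in> parcs G \<longleftrightarrow> {l u..r u} \<inter> {l v..r v} \<noteq> {}))"

definition interval_graph :: "'a pair_pre_digraph \<Rightarrow> bool" where
  "interval_graph G \<longleftrightarrow> pair_graph G \<and> (\<exists>l r. interval_representation G l r)"

text \<open>A triple \<open>(l, m, r)\<close> consists of left endpoint, approval mark and right endpoint.\<close>

type_synonym approval_triple = "real \<times> real \<times> real"

definition approval_interval :: "approval_triple \<Rightarrow> bool" where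
  "approval_interval = (\<lambda>(l, m, r). l < m \<and> m < r)"

definition support :: "approval_triple \<Rightarrow> real set" where
  "support = (\<lambda>(l, m, r). {l..r})"

definition mark :: "approval_triple \<Rightarrow> real" where
  "mark = (\<lambda>(l, m, r). m)"

text \<open>``Exactly one of the two marks'' is an exclusive or over the two vertices; in particular,
  two coinciding marks are either both contained or both not contained.\<close>

definition single_approval_representation ::
    "'a pair_pre_digraph \<Rightarrow> ('a \<Rightarrow> approval_triple) \<Rightarrow> bool" where
  "single_approval_representation G I \<longleftrightarrow>
     (\<forall>a \<in> pverts G. approval_interval (I a)) \<and>
     (\<forall>a \<in> pverts G. \<forall>b \<in> pverts G. a \<noteq> b \<longrightarrow>
        ((a, b) \<in> parcs G \<longleftrightarrow>
           support (I a) \<inter> support (I b) \<noteq> {} \<and>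
           (mark (I a) \<in> support (I a) \<inter> support (I b)) \<noteq>
           (mark (I b) \<in> support (I a) \<inter> support (I b))))"

definition single_approval_interval_graph :: "'a pair_pre_digraph \<Rightarrow> bool" where
  "single_approval_interval_graph G \<longleftrightarrow>
     pair_graph G \<and> (\<exists>I. single_approval_representation G I)"

end

theory Submission
  imports Defs
begin

text \<open>Intervals of an interval graph can be perturbed so that all left endpoints are distinct and the
  intersection pattern is unchanged. With each mark placed just right of its left endpoint, and left
  of the next left endpoint, two intersecting intervals share the mark of the one that starts later
  but not the mark of the other. Conversely, the 4-cycle is not an interval graph, but it is a single
  approval interval graph: two opposite vertices get the same long interval, containing both of their
  marks, and the other two get disjoint short intervals that avoid these marks.\<close>

lemma finite_separation:
  fixes S :: "real set"
  assumes "finite S"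
  obtains e where "e > 0" "\<And>x y. x \<in> S \<Longrightarrow> y \<in> S \<Longrightarrow> x < y \<Longrightarrow> x + e < y"
proof -
  \<comment> \<open>The extra element \<open>1\<close> keeps \<open>D\<close> nonempty, so that
    \<open>Min D\<close> exists even if \<open>S\<close> has at most one element.\<close>
  define D where "D = insert 1 ((\<lambda>(x, y). y - x) ` {(x, y) \<in> S \<times> S. x < y})"
  have fin: "finite D"
    unfolding D_def by (rule finite.insertI, rule finite_imageI)
      (rule finite_subset[OF _ finite_cartesian_product[OF assms assms]], blast)
  have "D \<noteq> {}" "\<forall>z \<in> D. z > 0"
    by (auto simp: D_def)
  with fin have pos: "Min D > 0" by simp
  have "x + Min D / 2 < y" if "x \<in> S" "y \<in> S" "x < y" for x y
  proof -
    have "y - x \<in> D" unfolding D_def using that by (intro insertI2 image_eqI[of _ _ "(x, y)"]) auto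
    then have "Min D \<le> y - x" using fin by simp
    then show ?thesis using pos by simp
  qed
  with pos that[of "Min D / 2"] show thesis by simp
qed

text \<open>Two nonempty closed intervals meet iff neither starts after the other ends; this turns
  adjacency into inequalities fit for linear arithmetic.\<close>

lemma interval_representationD:
  assumes "interval_representation G l r" "u \<in> pverts G"
  shows "l u \<le> r u"
    and "v \<in> pverts G \<Longrightarrow> u \<noteq> v \<Longrightarrow> (u, v) \<in> parcs G \<longleftrightarrow> l v \<le> r u \<and> l u \<le> r v"
proof -
  show *: "l u \<le> r u"
    using assms by (simp add: interval_representation_def)
  assume "v \<in> pverts G" "u \<noteq> v"
  then have "l v \<le> r v" and "(u, v) \<in> parcs G \<longleftrightarrow> {l u..r u} \<inter> {l v..r v} \<noteq> {}"
    using assms unfolding interval_representation_def by blast+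
  with * show "(u, v) \<in> parcs G \<longleftrightarrow> l v \<le> r u \<and> l u \<le> r v" by simp
qed

theorem interval_graph_imp_single_approval_interval_graph:
  assumes "interval_graph G"
  shows "single_approval_interval_graph G"
proof -
  from assms obtain l r where G: "pair_graph G" and rep: "interval_representation G l r"
    unfolding interval_graph_def by blast
  let ?V = "pverts G"
  have fin: "finite ?V"
    using G by (simp add: pair_graph_def pair_digraph_def pair_fin_digraph.pair_finite_verts)
  note lr = interval_representationD(1)[OF rep]
  note adj = interval_representationD(2)[OF rep]
  obtain e where e: "e > 0"
    and sep: "\<And>x y. x \<in> l ` ?V \<union> r ` ?V \<Longrightarrow> y \<in> l ` ?V \<union> r ` ?V \<Longrightarrow> x < y \<Longrightarrow> x + e < y"
    using finite_separation[of "l ` ?V \<union> r ` ?V"] fin by auto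
  \<comment> \<open>The numbering \<open>f\<close> breaks ties between equal left endpoints.\<close>
  obtain f :: "'a \<Rightarrow> nat" and n where f: "f ` ?V = {i. i < n}" "inj_on f ?V"
    using finite_imp_inj_to_nat_seg[OF fin] by metis
  \<comment> \<open>The summand \<open>1\<close> makes \<open>d * real n < e\<close> strict and
    avoids division by zero for the empty graph.\<close>
  define d where "d = e / (real n + 1)"
  have d: "d > 0" and dn: "d * real n < e"
    using e by (auto simp: d_def field_simps)
  define L where "L a = l a + d * real (f a)" for a
  define M where "M a = L a + d / 2" for a
  \<comment> \<open>Every right end moves by \<open>d * real n\<close>, more than any left end or
    mark, so touching intervals still meet; the move is below \<open>e\<close>, so disjoint ones
    stay disjoint.\<close>
  define R where "R a = r a + d * real n" for a
  define I where "I a = (L a, M a, R a)" for a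
  have shift: "L a + d \<le> l a + d * real n" "l a \<le> L a" if "a \<in> ?V" for a
  proof -
    \<comment> \<open>As \<open>f a + 1 \<le> n\<close>, a full step \<open>d\<close> is left for
      the mark, which sits only \<open>d / 2\<close> beyond \<open>L a\<close>.\<close>
    have "f a < n" using f(1) that by auto
    then have "d * (real (f a) + 1) \<le> d * real n" using d by (intro mult_left_mono) auto
    then show "L a + d \<le> l a + d * real n" by (simp add: L_def algebra_simps)
    show "l a \<le> L a" using d by (simp add: L_def)
  qed
  have appr: "L a < M a" "M a < R a" if "a \<in> ?V" for a
    using shift[OF that] lr[OF that] d by (auto simp: M_def R_def)
  have M_less_L: "M a < L b" if "a \<in> ?V" "b \<in> ?V" "l a < l b \<or> l a = l b \<and> f a < f b" for a b
    using that(3)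
  proof
    assume "l a < l b"
    then show ?thesis
      using sep[of "l a" "l b"] that shift[of a] shift[of b] d dn by (auto simp: M_def)
  next
    assume *: "l a = l b \<and> f a < f b"
    then have "d * (real (f a) + 1) \<le> d * real (f b)" using d by (intro mult_left_mono) auto
    with * d show ?thesis by (simp add: M_def L_def algebra_simps)
  qed
  have R_less_iff: "l b \<le> r a \<longleftrightarrow> M b \<le> R a" "l b \<le> r a \<longleftrightarrow> L b \<le> R a"
    if "a \<in> ?V" "b \<in> ?V" for a b
  proof -
    have "r a + e < l b" if "\<not> l b \<le> r a"
      using sep[of "r a" "l b"] that \<open>a \<in> ?V\<close> \<open>b \<in> ?V\<close> by simp
    then show "l b \<le> r a \<longleftrightarrow> M b \<le> R a" "l b \<le> r a \<longleftrightarrow> L b \<le> R a"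
      using shift[OF that(2)] d dn unfolding M_def R_def by linarith+
  qed
  \<comment> \<open>With \<open>a\<close> first in the lexicographic order of \<open>l\<close> and
    \<open>f\<close>, the mark of \<open>a\<close> lies before \<open>L b\<close>, so it is never
    shared. The exclusive or reduces to \<open>M b \<le> R a\<close>, that is,
    \<open>l b \<le> r a\<close>.\<close>
  have key: "(l b \<le> r a \<and> l a \<le> r b) \<longleftrightarrow>
      support (I a) \<inter> support (I b) \<noteq> {} \<and>
      (mark (I a) \<in> support (I a) \<inter> support (I b)) \<noteq>
      (mark (I b) \<in> support (I a) \<inter> support (I b))"
    if ab: "a \<in> ?V" "b \<in> ?V" and less: "l a < l b \<or> l a = l b \<and> f a < f b" for a b
  proof -
    have "l a \<le> r b" using less lr[OF ab(2)] by auto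
    moreover have "M a \<notin> {L b..R b}" using M_less_L[OF that] by simp
    moreover have "M b \<in> {L b..R b}" "L a \<le> M b"
      using appr[OF ab(1)] appr[OF ab(2)] M_less_L[OF that] by auto
    ultimately show ?thesis
      using R_less_iff[OF ab] by (auto simp: support_def mark_def I_def)
  qed
  have "single_approval_representation G I"
    unfolding single_approval_representation_def
  proof (intro conjI ballI impI)
    fix a assume "a \<in> ?V"
    then show "approval_interval (I a)" using appr by (simp add: approval_interval_def I_def)
  next
    fix a b assume ab: "a \<in> ?V" "b \<in> ?V" "a \<noteq> b"
    then have "f a \<noteq> f b" using f(2) by (auto dest: inj_onD)
    then consider "l a < l b \<or> l a = l b \<and> f a < f b" | "l b < l a \<or> l b = l a \<and> f b < f a"
      by linarith
    then show "(a, b) \<in> parcs G \<longleftrightarrow>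
        support (I a) \<inter> support (I b) \<noteq> {} \<and>
        (mark (I a) \<in> support (I a) \<inter> support (I b)) \<noteq>
        (mark (I b) \<in> support (I a) \<inter> support (I b))"
    proof cases
      case 1
      then show ?thesis using key[OF ab(1,2)] adj[OF ab] by simp
    next
      case 2
      then show ?thesis using key[OF ab(2,1)] adj[OF ab] by (auto simp: Int_commute)
    qed
  qed
  with G show ?thesis unfolding single_approval_interval_graph_def by blast
qed

definition cycle4 :: "nat pair_pre_digraph" where
  "cycle4 = \<lparr>pverts = {0, 1, 2, 3},
     parcs = {(0, 1), (1, 0), (1, 2), (2, 1), (2, 3), (3, 2), (3, 0), (0, 3)}\<rparr>"

lemma pair_graph_cycle4: "pair_graph cycle4"
  by unfold_locales (auto simp: cycle4_def symmetric_def sym_def)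

lemma single_approval_interval_graph_cycle4: "single_approval_interval_graph cycle4"
proof -
  \<comment> \<open>The default triple serves vertex \<open>3\<close>.\<close>
  define I :: "nat \<Rightarrow> approval_triple" where
    "I = (\<lambda>_. (6, 7, 8))(0 := (0, 4, 10), 1 := (1, 2, 3), 2 := (0, 5, 10))"
  have "single_approval_representation cycle4 I"
    by (simp add: single_approval_representation_def cycle4_def I_def approval_interval_def
        support_def mark_def)
  then show ?thesis
    using pair_graph_cycle4 unfolding single_approval_interval_graph_def by blast
qed

text \<open>The intervals of \<open>0\<close> and \<open>2\<close> are disjoint, and those of
  \<open>1\<close> and \<open>3\<close> meet both, so each covers the gap between them. Hence
  \<open>1\<close> and \<open>3\<close> would have to be adjacent.\<close>

lemma not_interval_graph_cycle4: "\<not> interval_graph cycle4"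
proof
  assume "interval_graph cycle4"
  then obtain l r where rep: "interval_representation cycle4 l r"
    unfolding interval_graph_def by blast
  note adj = interval_representationD(2)[OF rep]
  have "l 1 \<le> r 0 \<and> l 0 \<le> r 1" "l 2 \<le> r 1 \<and> l 1 \<le> r 2"
    "l 3 \<le> r 2 \<and> l 2 \<le> r 3" "l 0 \<le> r 3 \<and> l 3 \<le> r 0"
    "\<not> (l 2 \<le> r 0 \<and> l 0 \<le> r 2)" "\<not> (l 3 \<le> r 1 \<and> l 1 \<le> r 3)"
    using adj[of 0 1] adj[of 1 2] adj[of 2 3] adj[of 3 0] adj[of 0 2] adj[of 1 3]
    by (simp_all add: cycle4_def)
  then show False by linarith
qed

theorem theorem24:
  shows "(\<forall>G :: 'a pair_pre_digraph. interval_graph G \<longrightarrow> single_approval_interval_graph G) \<and>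
         (\<exists>H :: nat pair_pre_digraph. single_approval_interval_graph H \<and> \<not> interval_graph H)"
  using interval_graph_imp_single_approval_interval_graph
    single_approval_interval_graph_cycle4 not_interval_graph_cycle4 by blast

end
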